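(* Let $G=(V,E)$ be a finite undirected graph whose vertex set is a disjoint union $V=R\cup S$ with $R$ nonempty, let $\lambda>0$, and let $x_0\in\mathbb{R}^V$. Assume that every $s\in S$ is adjacent to every $v\in R$, and that there is $a\in\mathbb{R}$ such that $x_0(s)=a$ for all $s\in S$. Let $x_0^R\in\mathbb{R}^R$ be the restriction of $x_0$ to $R$ and $\overline{x}_0^R=\frac1{|R|}\sum_{v\in R}x_0^R(v)$. Assume that $\lambda\ge\|x_0^R-\overline{x}_0^R1_R\|_*$ and let $$x^*=\begin{cases} a & \text{if } |\overline{x}_0^R-a|\le\lambda|S|,\\ \overline{x}_0^R+\lambda|S| & \text{if } \overline{x}_0^R+\lambda|S|<a,\\ \overline{x}_0^R-\lambda|S| & \text{if } \overline{x}_0^R-\lambda|S|>a.\end{cases}$$ Then $x^*1_R$ is the unique minimizer of the problem $$\min_{x\in\mathbb{R}^R}\ \frac12\|x-x_0^R\|_2^2+\lambda\|x\|_{\mathrm{TV}}+\lambda\sum_{\substack{v\in R,\,w\in S\\ v\sim w}}|x(v)-x_0(w)|.$$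
   Context: $R$ is the set of regular agents and $S$ the set of stubborn agents; $v\sim w$ means $\{v,w\}\in E$. $\mathbb{R}^R$ is the space of functions $R\to\mathbb{R}$ with $\langle x,u\rangle=\sum_{v\in R}x(v)u(v)$ and $\|x\|_2^2=\langle x,x\rangle$; $1_R$ is the constant function $1$ on $R$. Here $\|\cdot\|_{\mathrm{TV}}$ and $\|\cdot\|_*$ refer to the subgraph $G(R)$ of $G$ induced by $R$: for $x\in\mathbb{R}^R$, $\|x\|_{\mathrm{TV}}=\sum_{\{v,w\}\in E,\ v,w\in R}|x(v)-x(w)|$, and for $u\in\mathbb{R}^R$ with $\sum_{v\in R}u(v)=0$, $\|u\|_*=\sup\{\langle x,u\rangle: x\in\mathbb{R}^R,\ \sum_{v\in R}x(v)=0,\ \|x\|_{\mathrm{TV}}\le1\}\in[0,+\infty]$ (this is the dual norm of $\|\cdot\|_{\mathrm{TV}}$ when $G(R)$ is connected). *)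

theory Defs
  imports "HOL-Analysis.Analysis"
begin

text \<open>
  Finite simple undirected graphs are given by a vertex set and a set of two-element edges.
  The space of real functions on a vertex set \<open>A\<close> is the set of extensional functions
  \<open>A \<rightarrow>\<^sub>E UNIV\<close>, so that two of its elements are equal iff they agree on \<open>A\<close>.
\<close>

definition finite_graph :: "'a set \<Rightarrow> 'a set set \<Rightarrow> bool" where
  "finite_graph V E \<longleftrightarrow> finite V \<and> (\<forall>e\<in>E. e \<subseteq> V \<and> card e = 2)"

abbreviation fun_space :: "'a set \<Rightarrow> ('a \<Rightarrow> real) set" where
  "fun_space A \<equiv> A \<rightarrow>\<^sub>E UNIV"

definition fun_inner :: "'a set \<Rightarrow> ('a \<Rightarrow> real) \<Rightarrow> ('a \<Rightarrow> real) \<Rightarrow> real" where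
  "fun_inner A x u = (\<Sum>v\<in>A. x v * u v)"

definition fun_mean :: "'a set \<Rightarrow> ('a \<Rightarrow> real) \<Rightarrow> real" where
  "fun_mean A x = (\<Sum>v\<in>A. x v) / real (card A)"

definition edge_diff :: "('a \<Rightarrow> real) \<Rightarrow> 'a set \<Rightarrow> real" where
  "edge_diff x e = (THE d. \<exists>v w. e = {v, w} \<and> d = \<bar>x v - x w\<bar>)"

lemma edge_diff_pair [simp]: "edge_diff x {v, w} = \<bar>x v - x w\<bar>"
  unfolding edge_diff_def
  by (rule the_equality) (auto simp: doubleton_eq_iff abs_minus_commute)

text \<open>
  Total variation over the subgraph induced by \<open>A\<close>: every undirected edge is counted once.
\<close>

definition tv_norm :: "'a set set \<Rightarrow> 'a set \<Rightarrow> ('a \<Rightarrow> real) \<Rightarrow> real" where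
  "tv_norm E A x = (\<Sum>e | e \<in> E \<and> e \<subseteq> A. edge_diff x e)"

text \<open>
  The supremum is taken in the extended reals: it is \<open>\<infinity>\<close> when the set of inner products is
  unbounded, which can happen if the subgraph induced by \<open>A\<close> is disconnected.
  It is meant for \<open>u\<close> with vanishing sum over \<open>A\<close>.
\<close>

definition tv_dual_norm :: "'a set set \<Rightarrow> 'a set \<Rightarrow> ('a \<Rightarrow> real) \<Rightarrow> ereal" where
  "tv_dual_norm E A u =
     (SUP x \<in> {x \<in> fun_space A. (\<Sum>v\<in>A. x v) = 0 \<and> tv_norm E A x \<le> 1}. ereal (fun_inner A x u))"

text \<open>
  The regular agents are \<open>R\<close>, the stubborn agents \<open>S\<close>.
  In the last sum \<open>v\<close> ranges over \<open>R\<close> and \<open>w\<close> over \<open>S\<close>; as \<open>R\<close> and \<open>S\<close> are disjoint,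
  every edge between them occurs exactly once.
\<close>

definition tv_objective ::
    "'a set set \<Rightarrow> 'a set \<Rightarrow> 'a set \<Rightarrow> real \<Rightarrow> ('a \<Rightarrow> real) \<Rightarrow> ('a \<Rightarrow> real) \<Rightarrow> real" where
  "tv_objective E R S l x0 x =
     1/2 * (L2_set (\<lambda>v. x v - restrict x0 R v) R)\<^sup>2
     + l * tv_norm E R x
     + l * (\<Sum>(v, w) | v \<in> R \<and> w \<in> S \<and> {v, w} \<in> E. \<bar>x v - x0 w\<bar>)"

text \<open>
  Here \<open>m\<close> is the mean and \<open>t\<close> the threshold \<open>\<lambda> |S|\<close>. If neither of the first two
  conditions holds then \<open>m - t > a\<close>, as the lemma after the definition shows.
\<close>

definition consensus_value :: "real \<Rightarrow> real \<Rightarrow> real \<Rightarrow> real" where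
  "consensus_value a m t =
     (if \<bar>m - a\<bar> \<le> t then a else if m + t < a then m + t else m - t)"

lemma consensus_value_cases:
  assumes "t \<ge> 0"
  shows "\<bar>m - a\<bar> \<le> t \<Longrightarrow> consensus_value a m t = a"
    and "m + t < a \<Longrightarrow> consensus_value a m t = m + t"
    and "m - t > a \<Longrightarrow> consensus_value a m t = m - t"
    and "\<bar>m - a\<bar> \<le> t \<or> m + t < a \<or> m - t > a"
  using assms by (auto simp: consensus_value_def)

end

theory Submission
  imports Defs
begin

text \<open>
  Put \<open>u = x0R - m\<close> with \<open>m\<close> the mean of \<open>x0R\<close>, \<open>t = \<lambda>|S|\<close> and \<open>c = x*\<close>; on the complete bipartite
  part the objective is \<open>t \<Sum>\<^sub>v |x(v) - a|\<close>. Expanding the square around the constant \<open>c\<close>, the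
  objective at \<open>x\<close> exceeds its value at \<open>c\<close> by \<open>|x - c|^2/2\<close>, plus
  \<open>\<lambda> TV(x) - \<langle>x, u\<rangle>\<close>, which is nonnegative by duality, plus the sum over \<open>v\<close> of
  \<open>(x(v) - c)(c - m) + t|x(v) - a| - t|c - a|\<close>, which is nonnegative because \<open>c\<close> minimizes
  the convex function \<open>(z - m)^2/2 + t|z - a|\<close> of one variable.
\<close>

lemma tv_norm_nonneg:
  assumes "\<forall>e\<in>E. card e = 2"
  shows "tv_norm E A x \<ge> 0"
  unfolding tv_norm_def using assms by (intro sum_nonneg) (auto simp: card_2_iff)

text \<open>A shift cancels in every edge difference and \<open>k\<close> factors out. Restricting
  to \<open>A\<close> keeps the function in \<open>fun_space A\<close> and is harmless, as only
  edges inside \<open>A\<close> count.\<close>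

lemma tv_norm_affine:
  assumes "\<forall>e\<in>E. card e = 2"
  shows "tv_norm E A (\<lambda>v\<in>A. k * x v + d) = \<bar>k\<bar> * tv_norm E A x"
proof -
  have "edge_diff (\<lambda>v\<in>A. k * x v + d) e = \<bar>k\<bar> * edge_diff x e" if "e \<in> E" "e \<subseteq> A" for e
  proof -
    obtain v w where "e = {v, w}"
      using assms \<open>e \<in> E\<close> by (meson card_2_iff)
    then show ?thesis
      using \<open>e \<subseteq> A\<close> by (simp flip: abs_mult add: right_diff_distrib)
  qed
  then show ?thesis
    by (simp add: tv_norm_def sum_distrib_left)
qed

lemma tv_norm_const:
  assumes "\<forall>e\<in>E. card e = 2"
  shows "tv_norm E A (\<lambda>v\<in>A. d) = 0"
  using tv_norm_affine[OF assms, of A 0 "\<lambda>_. 0" d] by simp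

lemma fun_mean_centered:
  assumes "finite A" "A \<noteq> {}"
  shows "(\<Sum>v\<in>A. x v - fun_mean A x) = 0"
  using assms by (simp add: sum_subtractf fun_mean_def)

text \<open>Centering \<open>x\<close> changes neither side, because \<open>u\<close> has zero sum
  and total variation ignores constants. Scaling then makes \<open>x\<close> admissible in the
  supremum defining the dual norm.\<close>

lemma fun_inner_le_tv_norm:
  assumes E: "\<forall>e\<in>E. card e = 2" and A: "finite A" "A \<noteq> {}"
    and "l > 0" and dual: "tv_dual_norm E A u \<le> ereal l" and u: "(\<Sum>v\<in>A. u v) = 0"
  shows "fun_inner A x u \<le> l * tv_norm E A x"
proof (rule field_le_epsilon)
  fix \<epsilon> :: real
  assume "\<epsilon> > 0"
  \<comment> \<open>Dividing by something strictly larger than the total variation also covers total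
    variation \<open>0\<close>.\<close>
  define k where "k = tv_norm E A x + \<epsilon> / l"
  define y where "y = (\<lambda>v\<in>A. 1 / k * x v + - fun_mean A x / k)"
  have "\<epsilon> / l > 0"
    using \<open>\<epsilon> > 0\<close> \<open>l > 0\<close> by simp
  then have "k > 0" "tv_norm E A x \<le> k"
    using tv_norm_nonneg[OF E, of A x] by (auto simp: k_def)
  have y: "y v = (x v - fun_mean A x) / k" if "v \<in> A" for v
    using that by (simp add: y_def diff_divide_distrib)
  have "tv_norm E A y = tv_norm E A x / k"
    unfolding y_def tv_norm_affine[OF E] using \<open>k > 0\<close> by simp
  then have "tv_norm E A y \<le> 1"
    using \<open>k > 0\<close> \<open>tv_norm E A x \<le> k\<close> by simp
  moreover have "(\<Sum>v\<in>A. y v) = 0"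
    using fun_mean_centered[OF A] by (simp add: y flip: sum_divide_distrib)
  moreover have "y \<in> fun_space A"
    by (simp add: y_def)
  ultimately have "ereal (fun_inner A y u) \<le> tv_dual_norm E A u"
    unfolding tv_dual_norm_def by (intro SUP_upper) simp
  with dual have "fun_inner A y u \<le> l"
    by (metis ereal_less_eq(3) order_trans)
  moreover have "fun_inner A y u = fun_inner A x u / k"
  proof -
    have "fun_inner A y u = (\<Sum>v\<in>A. x v * u v - fun_mean A x * u v) / k"
      by (simp add: fun_inner_def y left_diff_distrib flip: sum_divide_distrib)
    also have "\<dots> = fun_inner A x u / k"
      by (simp add: sum_subtractf u fun_inner_def flip: sum_distrib_left)
    finally show ?thesis .
  qed
  ultimately have "fun_inner A x u \<le> l * k"
    using \<open>k > 0\<close> by (simp add: pos_divide_le_eq)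
  then show "fun_inner A x u \<le> l * tv_norm E A x + \<epsilon>"
    using \<open>l > 0\<close> by (simp add: k_def distrib_left)
qed

text \<open>
  First-order optimality: \<open>m - c\<close> is a subgradient of \<open>t|z - a|\<close> at \<open>z = c\<close>.
\<close>

lemma consensus_value_optimal:
  assumes "t \<ge> 0" "c = consensus_value a m t"
  shows "t * \<bar>c - a\<bar> \<le> (z - c) * (c - m) + t * \<bar>z - a\<bar>"
proof -
  consider "\<bar>m - a\<bar> \<le> t" "c = a" | "m + t < a" "c = m + t" | "m - t > a" "c = m - t"
    using consensus_value_cases[OF \<open>t \<ge> 0\<close>] assms(2) by metis
  then show ?thesis
  proof cases
    case 1
    have "\<bar>(z - a) * (a - m)\<bar> \<le> \<bar>z - a\<bar> * t"
      unfolding abs_mult using 1 by (intro mult_left_mono) (auto simp: abs_minus_commute)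
    then show ?thesis
      using 1 by (simp add: mult.commute abs_le_iff)
  next
    \<comment> \<open>Here \<open>c - m = t\<close> and \<open>\<bar>c - a\<bar> = a - c\<close>, so
      the right side minus the left is exactly this product; the next case is its mirror
      image.\<close>
    case 2
    have "0 \<le> t * ((z - a) + \<bar>z - a\<bar>)"
      using \<open>t \<ge> 0\<close> by (intro mult_nonneg_nonneg) auto
    then show ?thesis
      using 2 by (simp add: algebra_simps)
  next
    case 3
    have "0 \<le> t * ((a - z) + \<bar>z - a\<bar>)"
      using \<open>t \<ge> 0\<close> by (intro mult_nonneg_nonneg) auto
    moreover have "m = c + t" "\<bar>c - a\<bar> = c - a"
      using 3 by auto
    ultimately show ?thesis
      by (simp add: algebra_simps)
  qed
qed

text \<open>All pairs in \<open>R \<times> S\<close> are edges and all stubborn values equal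
  \<open>a\<close>, so each regular agent sees \<open>card S\<close> equal terms.\<close>

lemma tv_objective_complete:
  assumes "\<And>s v. s \<in> S \<Longrightarrow> v \<in> R \<Longrightarrow> {s, v} \<in> E" "\<And>s. s \<in> S \<Longrightarrow> x0 s = a"
  shows "tv_objective E R S l x0 x =
    (\<Sum>v\<in>R. (x v - x0 v)\<^sup>2 / 2 + l * real (card S) * \<bar>x v - a\<bar>) + l * tv_norm E R x"
proof -
  have "{(v, w). v \<in> R \<and> w \<in> S \<and> {v, w} \<in> E} = R \<times> S"
    using assms(1) by (force simp: doubleton_eq_iff insert_commute)
  then have "(\<Sum>(v, w) | v \<in> R \<and> w \<in> S \<and> {v, w} \<in> E. \<bar>x v - x0 w\<bar>)
      = (\<Sum>v\<in>R. \<Sum>w\<in>S. \<bar>x v - x0 w\<bar>)"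
    by (simp add: sum.cartesian_product)
  also have "\<dots> = (\<Sum>v\<in>R. real (card S) * \<bar>x v - a\<bar>)"
    using assms(2) by simp
  finally have cross: "(\<Sum>(v, w) | v \<in> R \<and> w \<in> S \<and> {v, w} \<in> E. \<bar>x v - x0 w\<bar>)
      = (\<Sum>v\<in>R. real (card S) * \<bar>x v - a\<bar>)" .
  have "(L2_set (\<lambda>v. x v - restrict x0 R v) R)\<^sup>2 = (\<Sum>v\<in>R. (x v - x0 v)\<^sup>2)"
    by (simp add: L2_set_def sum_nonneg)
  then show ?thesis
    unfolding tv_objective_def cross
    by (simp add: sum.distrib sum_distrib_left sum_divide_distrib mult.assoc)
qed

theorem theorem4:
  fixes V R S :: "'a set" and E :: "'a set set"
    and l a xstar :: real and x0 x0R :: "'a \<Rightarrow> real"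
  assumes "finite_graph V E"
    and "V = R \<union> S" and "R \<inter> S = {}" and "R \<noteq> {}"
    and "l > 0"
    and "x0 \<in> fun_space V"
    and "\<And>s v. s \<in> S \<Longrightarrow> v \<in> R \<Longrightarrow> {s, v} \<in> E"
    and "\<And>s. s \<in> S \<Longrightarrow> x0 s = a"
    and "x0R = restrict x0 R"
    and "ereal l \<ge> tv_dual_norm E R (\<lambda>v\<in>R. x0R v - fun_mean R x0R)"
    and "xstar = consensus_value a (fun_mean R x0R) (l * real (card S))"
  shows "\<forall>x. is_arg_min (tv_objective E R S l x0) (\<lambda>y. y \<in> fun_space R) x
           \<longleftrightarrow> x = (\<lambda>v\<in>R. xstar)"
proof -
  define m where "m = fun_mean R x0R"
  define t where "t = l * real (card S)"
  define u where "u = (\<lambda>v\<in>R. x0R v - m)"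
  define c where "c = (\<lambda>v\<in>R. xstar)"
  let ?F = "tv_objective E R S l x0"
  have E: "\<forall>e\<in>E. card e = 2" and R: "finite R"
    using assms(1,2) by (auto simp: finite_graph_def)
  have "t \<ge> 0"
    using \<open>l > 0\<close> by (simp add: t_def)
  have u: "(\<Sum>v\<in>R. u v) = 0"
    using fun_mean_centered[OF R \<open>R \<noteq> {}\<close>, of x0R] by (simp add: u_def m_def)
  have F: "?F x = (\<Sum>v\<in>R. (x v - x0 v)\<^sup>2 / 2 + t * \<bar>x v - a\<bar>) + l * tv_norm E R x" for x
    unfolding t_def by (rule tv_objective_complete) (use assms in auto)
  \<comment> \<open>Strong convexity around \<open>c\<close>: the quadratic gap yields both
    minimality and uniqueness.\<close>
  have growth: "?F c + (\<Sum>v\<in>R. (x v - xstar)\<^sup>2 / 2) \<le> ?F x" for x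
  proof -
    have dual: "fun_inner R x u \<le> l * tv_norm E R x"
      using E R \<open>R \<noteq> {}\<close> \<open>l > 0\<close> assms(10)[folded m_def, folded u_def] u
      by (rule fun_inner_le_tv_norm)
    have "?F c + (\<Sum>v\<in>R. (x v - xstar)\<^sup>2 / 2)
        = (\<Sum>v\<in>R. (xstar - x0 v)\<^sup>2 / 2 + t * \<bar>xstar - a\<bar> + (x v - xstar)\<^sup>2 / 2)"
      by (simp add: F c_def tv_norm_const[OF E] sum.distrib)
    \<comment> \<open>The linear terms in \<open>u\<close> make the comparison hold vertex by
      vertex. They add up to \<open>fun_inner R x u\<close>, since \<open>u\<close> sums to zero,
      and duality absorbs this into the total variation.\<close>
    also have "\<dots> \<le> (\<Sum>v\<in>R. (x v - x0 v)\<^sup>2 / 2 + t * \<bar>x v - a\<bar> + (x v * u v - xstar * u v))"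
    proof (rule sum_mono)
      fix v assume "v \<in> R"
      then have x0: "x0 v = m + u v"
        by (simp add: u_def assms(9))
      have "(x v - x0 v)\<^sup>2 / 2 + (x v * u v - xstar * u v) =
          (xstar - x0 v)\<^sup>2 / 2 + (x v - xstar)\<^sup>2 / 2 + (x v - xstar) * (xstar - m)"
        unfolding x0 by (simp add: power2_eq_square field_simps)
      then show "(xstar - x0 v)\<^sup>2 / 2 + t * \<bar>xstar - a\<bar> + (x v - xstar)\<^sup>2 / 2
          \<le> (x v - x0 v)\<^sup>2 / 2 + t * \<bar>x v - a\<bar> + (x v * u v - xstar * u v)"
        using consensus_value_optimal[OF \<open>t \<ge> 0\<close>, of xstar a m "x v"] assms(11)
        by (simp add: m_def t_def)
    qed
    also have "\<dots> = (\<Sum>v\<in>R. (x v - x0 v)\<^sup>2 / 2 + t * \<bar>x v - a\<bar>) + fun_inner R x u"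
      by (simp add: sum.distrib sum_subtractf fun_inner_def sum_distrib_left[symmetric, of xstar] u)
    also have "\<dots> \<le> ?F x"
      using dual by (simp add: F)
    finally show ?thesis .
  qed
  have min: "?F c \<le> ?F x" for x
    using growth[of x] sum_nonneg[of R "\<lambda>v. (x v - xstar)\<^sup>2 / 2"] by simp
  have c: "c \<in> fun_space R"
    by (simp add: c_def)
  have unique: "x = c" if "x \<in> fun_space R" "?F x \<le> ?F c" for x
  proof -
    have "(\<Sum>v\<in>R. (x v - xstar)\<^sup>2 / 2) = 0"
      using growth[of x] that(2) by (intro antisym sum_nonneg) auto
    then have "\<forall>v\<in>R. x v = xstar"
      using R by (subst (asm) sum_nonneg_eq_0_iff) auto
    \<comment> \<open>Both functions are extensional, so agreement on \<open>R\<close>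
      suffices.\<close>
    then show ?thesis
      by (intro PiE_ext[OF that(1) c]) (simp add: c_def)
  qed
  show ?thesis
    unfolding c_def[symmetric]
  proof (intro allI iffI)
    fix x assume "is_arg_min ?F (\<lambda>y. y \<in> fun_space R) x"
    then show "x = c"
      by (intro unique) (use c in \<open>auto simp: is_arg_min_linorder\<close>)
  next
    fix x assume "x = c"
    then show "is_arg_min ?F (\<lambda>y. y \<in> fun_space R) x"
      using c min by (simp add: is_arg_min_linorder)
  qed
qed

end
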